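(* Let $\alpha$ be a positive integer, $s\ge 1$ an integer, $n\in\frac12\mathbb Z$, and let $\lambda=(\lambda_1,\dots,\lambda_s)$ be a partition. Put $\lambda^{(i)}=(\lambda_1,\dots,\lambda_i)$, so $|\lambda^{(i)}|=\lambda_1+\cdots+\lambda_i$. Then $$X_{-\lambda_s}\cdots X_{-\lambda_1}.e^{nh}=\sum_{\underline{\mu},\underline{\nu}}\ \prod_{i=1}^s\frac{(-2\alpha)^{l(\nu^i)}}{z_{\nu^i}}\binom{m(\mu^{i-1})}{m(\mu^i\backslash\nu^i)}\ \frac{h_{-\mu^s}}{(-2)^{l(\mu^s)}}\otimes e^{(n+s)h},$$ where the sum is over all sequences of partitions $\underline\mu=(\mu^1,\dots,\mu^s)$ and $\underline\nu=(\nu^1,\dots,\nu^s)$ such that for every $i=1,\dots,s$: $\nu^i\subset'\mu^i$, $|\mu^i|=|\lambda^{(i)}|-i(2n+i)\alpha$, and $\mu^i\backslash\nu^i\subset'\mu^{i-1}$, with $\mu^0=(0)$ the empty partition.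
   Context: Partitions: $\lambda=(\lambda_1\ge\lambda_2\ge\cdots)$ are finite nonincreasing sequences of nonnegative integers, also written $(1^{m_1}2^{m_2}\cdots)$ with $m_i$ the multiplicity of $i$; $|\lambda|$ is the sum of the parts, $l(\lambda)$ the number of nonzero parts, $z_\lambda=\prod_{i\ge1}i^{m_i}m_i!$. For $\lambda=(1^{m_1}2^{m_2}\cdots)$ and $\mu=(1^{n_1}2^{n_2}\cdots)$, $\mu\subset'\lambda$ means $n_i\le m_i$ for all $i$; in that case $\lambda\backslash\mu=(1^{m_1-n_1}2^{m_2-n_2}\cdots)$ and $\binom{m(\lambda)}{m(\mu)}=\prod_i\binom{m_i}{n_i}$. Space: $V_0=\mathbb C[h_{-1},h_{-2},\dots]$ is the polynomial algebra; for $n>0$, $h_{-n}$ acts by multiplication and $h_n$ acts as $\alpha^{-1}n\,\partial/\partial h_{-n}$. Put $h_{-\lambda}=h_{-\lambda_1}h_{-\lambda_2}\cdots$ (product over nonzero parts). $V=V_0\otimes\mathbb C[\frac12\mathbb Z]$, where $\mathbb C[\frac12\mathbb Z]$ has basis $\{e^{sh}:s\in\frac12\mathbb Z\}$ with $e^{sh}e^{th}=e^{(s+t)h}$; the $h_{\pm n}$ act on the first factor, and $e^{sh}$ denotes $1\otimes e^{sh}$. Vertex operator: $$X(z)=\exp\Big(\sum_{n\ge1}\frac{z^n}{n}\alpha h_{-n}\Big)\exp(2\alpha\ln z\,\partial_h+h)\exp\Big(\sum_{n\ge1}\frac{z^{-n}}{-n}2\alpha h_n\Big)=\sum_{n\in\mathbb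 Z}X_nz^{-n},$$ where the middle factor acts on the second tensor factor by $e^{sh}\mapsto z^{(s+\frac12)2\alpha}e^{(s+1)h}$. Thus $X_{-k}$ is the coefficient of $z^k$ in $X(z)$. *)

theory Defs
  imports Complex_Main "HOL-Library.Poly_Mapping" "HOL-Library.Multiset" "HOL-Library.FuncSet"
begin

text \<open>Partitions that are identified by their multiplicities are multisets of positive
  integers: \<open>m\<^sub>i\<close> is \<^const>\<open>count\<close>, the weight is \<^const>\<open>sum_mset\<close>, the length is \<^const>\<open>size\<close>,
  containment of multiplicities is \<^const>\<open>subseteq_mset\<close>, and the difference of partitions is the
  difference of multisets.\<close>

definition partitions :: "nat multiset set" where
  "partitions = {p. 0 \<notin># p}"

definition zee :: "nat multiset \<Rightarrow> nat" where
  "zee p = (\<Prod>i\<in>set_mset p. i ^ count p i * fact (count p i))"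

text \<open>Only used when \<open>q \<subseteq># p\<close>; every part outside \<open>p\<close> then contributes the factor 1.\<close>

definition mbinom :: "nat multiset \<Rightarrow> nat multiset \<Rightarrow> nat" where
  "mbinom p q = (\<Prod>i\<in>set_mset p. count p i choose count q i)"

text \<open>Polynomials in \<open>h\<^sub>-\<^sub>1, h\<^sub>-\<^sub>2, \<dots>\<close>: the variable with index \<open>i\<close> is \<open>h\<^sub>-\<^sub>(\<^sub>i\<^sub>+\<^sub>1\<^sub>)\<close>, so that there
  is no variable \<open>h\<^sub>0\<close>.\<close>

type_synonym V0 = "(nat \<Rightarrow>\<^sub>0 nat) \<Rightarrow>\<^sub>0 complex"

text \<open>The tensor product with the group algebra of the half-integers, as the group algebra with
  coefficients in \<^typ>\<open>V0\<close>.  The half-integer \<open>s\<close> is represented by the integer \<open>2 * s\<close>, so the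
  coefficient of \<open>e\<^sup>s\<^sup>h\<close> is the value at \<open>2 * s\<close>.\<close>

type_synonym V = "int \<Rightarrow>\<^sub>0 V0"

definition smul0 :: "complex \<Rightarrow> V0 \<Rightarrow> V0" where
  "smul0 c f = Poly_Mapping.single 0 c * f"

definition smul :: "complex \<Rightarrow> V \<Rightarrow> V" where
  "smul c v = Poly_Mapping.single 0 (Poly_Mapping.single 0 c) * v"

text \<open>\<open>tensor f s\<close> is \<open>f \<otimes> e\<^sup>s\<^sup>h\<close>; it is meaningful only for \<open>2 * s \<in> \<int>\<close>.\<close>

definition tensor :: "V0 \<Rightarrow> rat \<Rightarrow> V" where
  "tensor f s = Poly_Mapping.single \<lfloor>2 * s\<rfloor> f"

text \<open>\<open>hvar n\<close> is \<open>h\<^sub>-\<^sub>n\<close>, for \<open>n > 0\<close>.\<close>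

definition hvar :: "nat \<Rightarrow> V0" where
  "hvar n = Poly_Mapping.single (Poly_Mapping.single (n - 1) 1) 1"

text \<open>\<open>hmono p\<close> is \<open>h\<^sub>-\<^sub>p\<close>.\<close>

definition hmono :: "nat multiset \<Rightarrow> V0" where
  "hmono p = (\<Prod>i\<in>#p. hvar i)"

text \<open>The partial derivative with respect to \<open>h\<^sub>-\<^sub>n\<close>, for \<open>n > 0\<close>.\<close>

definition hderiv :: "nat \<Rightarrow> V0 \<Rightarrow> V0" where
  "hderiv n f = (\<Sum>m\<in>Poly_Mapping.keys f.
     Poly_Mapping.single (m - Poly_Mapping.single (n - 1) 1)
       (of_nat (Poly_Mapping.lookup m (n - 1)) * Poly_Mapping.lookup f m))"

text \<open>The actions of \<open>h\<^sub>-\<^sub>n\<close> and of \<open>h\<^sub>n\<close> on \<^typ>\<open>V\<close>, for \<open>n > 0\<close>.\<close>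

definition h_neg :: "nat \<Rightarrow> V \<Rightarrow> V" where
  "h_neg n v = Poly_Mapping.map (\<lambda>f. hvar n * f) v"

definition h_pos :: "nat \<Rightarrow> nat \<Rightarrow> V \<Rightarrow> V" where
  "h_pos \<alpha> n v = Poly_Mapping.map (\<lambda>f. smul0 (inverse (of_nat \<alpha>) * of_nat n) (hderiv n f)) v"

text \<open>\<open>ser_pow a k m\<close> is the coefficient of \<open>w\<^sup>m\<close> in the \<open>k\<close>-th power of the operator-valued
  series \<open>\<Sum>\<^sub>n\<^sub>\<ge>\<^sub>1 a\<^sub>n w\<^sup>n\<close>, and \<open>ser_exp a m\<close> is its coefficient in the exponential of that series.
  Only the powers \<open>k \<le> m\<close> contribute to the latter.\<close>

primrec ser_pow :: "(nat \<Rightarrow> V \<Rightarrow> V) \<Rightarrow> nat \<Rightarrow> nat \<Rightarrow> V \<Rightarrow> V" where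
  "ser_pow a 0 m v = (v when m = 0)"
| "ser_pow a (Suc k) m v = (\<Sum>n=1..m. a n (ser_pow a k (m - n) v))"

definition ser_exp :: "(nat \<Rightarrow> V \<Rightarrow> V) \<Rightarrow> nat \<Rightarrow> V \<Rightarrow> V" where
  "ser_exp a m v = Sum_any (\<lambda>k. smul (1 / fact k) (ser_pow a k m v))"

text \<open>The coefficient of \<open>z\<^sup>p\<close> in the first factor, and of \<open>z\<^sup>-\<^sup>q\<close> in the last one.\<close>

definition X_left :: "nat \<Rightarrow> nat \<Rightarrow> V \<Rightarrow> V" where
  "X_left \<alpha> p = ser_exp (\<lambda>n v. smul (of_nat \<alpha> / of_nat n) (h_neg n v)) p"

definition X_right :: "nat \<Rightarrow> nat \<Rightarrow> V \<Rightarrow> V" where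
  "X_right \<alpha> q = ser_exp (\<lambda>n v. smul (2 * of_nat \<alpha> / (- of_nat n)) (h_pos \<alpha> n v)) q"

text \<open>The coefficient of \<open>z\<^sup>j\<close> in the middle factor, which maps \<open>e\<^sup>s\<^sup>h\<close> to
  \<open>z\<close> to the power \<open>(s + 1/2) * 2 * \<alpha>\<close> times the basis element of \<open>s + 1\<close>;
  here \<open>t = 2 * s\<close>.\<close>

definition X_mid :: "nat \<Rightarrow> int \<Rightarrow> V \<Rightarrow> V" where
  "X_mid \<alpha> j v = (\<Sum>t\<in>Poly_Mapping.keys v.
     let s = (of_int t / 2 :: rat) in
       tensor (Poly_Mapping.lookup v t) (s + 1)
         when (s + 1 / 2) * 2 * of_nat \<alpha> = of_int j)"

text \<open>\<open>X_op \<alpha> n\<close> is \<open>X\<^sub>n\<close>, the coefficient of \<open>z\<^sup>-\<^sup>n\<close> in the product of the three factors.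
  On each vector only finitely many terms of this sum are nonzero, because \<open>X_right \<alpha> q v\<close>
  vanishes for large \<open>q\<close>.\<close>

definition X_op :: "nat \<Rightarrow> int \<Rightarrow> V \<Rightarrow> V" where
  "X_op \<alpha> n v = Sum_any (\<lambda>(p, j, q).
     X_left \<alpha> p (X_mid \<alpha> j (X_right \<alpha> q v)) when int p + j - int q = - n)"

text \<open>The pairs \<open>((\<mu>\<^sup>0, \<dots>, \<mu>\<^sup>s), (\<nu>\<^sup>1, \<dots>, \<nu>\<^sup>s))\<close> with \<open>\<mu>\<^sup>0\<close> the empty partition, where \<open>s\<close> is the
  length of \<open>lam\<close>; \<open>sum_list (take i lam)\<close> is the sum of the first \<open>i\<close> parts.  The condition on the
  weights is an equation between rationals: it fails when its right-hand side is negative.\<close>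

definition index_seqs ::
  "nat \<Rightarrow> rat \<Rightarrow> nat list \<Rightarrow> ((nat \<Rightarrow> nat multiset) \<times> (nat \<Rightarrow> nat multiset)) set" where
  "index_seqs \<alpha> n lam = {(\<mu>, \<nu>).
     \<mu> \<in> {0..length lam} \<rightarrow>\<^sub>E partitions \<and> \<nu> \<in> {1..length lam} \<rightarrow>\<^sub>E partitions \<and> \<mu> 0 = {#} \<and>
     (\<forall>i\<in>{1..length lam}.
        \<nu> i \<subseteq># \<mu> i \<and>
        of_nat (sum_mset (\<mu> i)) =
          of_nat (sum_list (take i lam)) - of_nat i * (2 * n + of_nat i) * of_nat \<alpha> \<and>
        \<mu> i - \<nu> i \<subseteq># \<mu> (i - 1))}"

end

theory Submission
  imports Defs
begin

text \<open>
  By the multinomial theorem, the first exponential of the vertex operator has the coefficients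
  \<open>\<Sum> \<alpha>\<^bsup>l(\<nu>)\<^esup> / z\<^sub>\<nu> h\<^sub>-\<^sub>\<nu>\<close> over the partitions \<open>\<nu>\<close> of a given weight.  The last one is
  \<open>exp (- 2 \<Sum> z\<^sup>-\<^sup>n \<partial>/\<partial>h\<^sub>-\<^sub>n)\<close>, the substitution \<open>h\<^sub>-\<^sub>n \<mapsto> h\<^sub>-\<^sub>n - 2 z\<^sup>-\<^sup>n\<close>, which sends \<open>h\<^sub>-\<^sub>\<mu>\<close>
  to a binomial sum over the submultisets \<open>\<kappa>\<close> of \<open>\<mu>\<close>.  Hence \<open>X\<^sub>-\<^sub>k\<close> applied to
  \<open>h\<^sub>-\<^sub>\<mu> / (-2)\<^bsup>l(\<mu>)\<^esup> \<otimes> e\<^sup>s\<^sup>h\<close> is a sum over pairs \<open>(\<mu>', \<nu>)\<close> with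
  \<open>\<mu>' = \<nu> + (\<mu> - \<kappa>)\<close>, where the power of \<open>z\<close> fixes the weight of \<open>\<mu>'\<close>.  The theorem is the
  iteration of this one-step formula.
\<close>

subsection \<open>Linearity of the operators\<close>

interpretation V0: vector_space smul0
  by unfold_locales (simp_all add: smul0_def distrib_left distrib_right single_add
      mult.assoc [symmetric] mult_single)

interpretation V: vector_space smul
  by unfold_locales (simp_all add: smul_def distrib_left distrib_right single_add
      mult.assoc [symmetric] mult_single)

abbreviation linear_V :: "(V \<Rightarrow> V) \<Rightarrow> bool" where
  "linear_V \<equiv> Vector_Spaces.linear smul smul"

lemma linear_V_iff:
  "linear_V f \<longleftrightarrow> (\<forall>x y. f (x + y) = f x + f y) \<and> (\<forall>c x. f (smul c x) = smul c (f x))"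
  by (simp add: Vector_Spaces.linear_iff V.vector_space_axioms)

lemma linear_V_sum: "linear_V f \<Longrightarrow> f (sum g A) = (\<Sum>x\<in>A. f (g x))"
  by (auto simp: Vector_Spaces.linear_def intro: module_hom.sum)

lemma linear_V_0: "linear_V f \<Longrightarrow> f 0 = 0"
  by (auto simp: Vector_Spaces.linear_def intro: module_hom.zero)

lemma linear_V_scale: "linear_V f \<Longrightarrow> f (smul c x) = smul c (f x)"
  by (simp add: linear_V_iff)

lemma smul_single: "smul c (Poly_Mapping.single t f) = Poly_Mapping.single t (smul0 c f)"
  by (simp add: smul_def smul0_def mult_single)

lemma lookup_smul0: "Poly_Mapping.lookup (smul0 c v) t = c * Poly_Mapping.lookup v t"
  unfolding smul0_def mult_map_scale_conv_mult [symmetric]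
  by (simp add: Poly_Mapping.map.rep_eq when_def)

lemma lookup_smul: "Poly_Mapping.lookup (smul c v) t = smul0 c (Poly_Mapping.lookup v t)"
proof -
  have "smul c v = Poly_Mapping.map ((*) (Poly_Mapping.single 0 c)) v"
    by (simp only: smul_def mult_map_scale_conv_mult)
  then show ?thesis
    by (simp add: Poly_Mapping.map.rep_eq when_def smul0_def)
qed

lemma smul0_mult_right: "f * smul0 c g = smul0 c (f * g)"
  by (simp add: smul0_def ac_simps)

text \<open>Everything is checked coefficientwise. \<open>Poly_Mapping.map\<close> applies
  \<open>f\<close> only to nonzero coefficients, so \<open>f 0 = 0\<close> is what makes
  \<open>lookup\<close> commute with it.\<close>

lemma linear_V_map:
  assumes "Vector_Spaces.linear smul0 smul0 f"
  shows "linear_V (Poly_Mapping.map f)"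
proof -
  have f: "f 0 = 0" "\<And>x y. f (x + y) = f x + f y" "\<And>c x. f (smul0 c x) = smul0 c (f x)"
    using assms by (auto simp: Vector_Spaces.linear_def intro: module_hom.zero module_hom.add module_hom.scale)
  have map: "Poly_Mapping.lookup (Poly_Mapping.map f v) t = f (Poly_Mapping.lookup v t)" for v t
    by (simp add: Poly_Mapping.map.rep_eq when_def f(1))
  show ?thesis
    unfolding linear_V_iff
  proof (intro conjI allI)
    show "Poly_Mapping.map f (x + y) = Poly_Mapping.map f x + Poly_Mapping.map f y" for x y
      by (rule poly_mapping_eqI) (simp only: map lookup_add f)
    show "Poly_Mapping.map f (smul c x) = smul c (Poly_Mapping.map f x)" for c x
      by (rule poly_mapping_eqI) (simp only: map lookup_smul f)
  qed
qed

text \<open>Terms may cancel in a sum, so the key sets of \<open>x\<close>, \<open>y\<close> and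
  \<open>x + y\<close> can differ. Summing over a common finite set of exponents makes additivity
  visible.\<close>

lemma hderiv_superset:
  assumes "finite S" "Poly_Mapping.keys f \<subseteq> S"
  shows "hderiv n f = (\<Sum>m\<in>S. Poly_Mapping.single (m - Poly_Mapping.single (n - 1) 1)
       (of_nat (Poly_Mapping.lookup m (n - 1)) * Poly_Mapping.lookup f m))"
  unfolding hderiv_def using assms
  by (intro sum.mono_neutral_left) (auto simp: in_keys_iff)

lemma linear_hderiv: "Vector_Spaces.linear smul0 smul0 (hderiv n)"
proof -
  have "hderiv n (x + y) = hderiv n x + hderiv n y" for x y
  proof -
    let ?S = "Poly_Mapping.keys x \<union> Poly_Mapping.keys y"
    have "Poly_Mapping.keys (x + y) \<subseteq> ?S" by (rule Poly_Mapping.keys_add)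
    then show ?thesis
      by (simp add: hderiv_superset [of ?S] lookup_add distrib_left single_add sum.distrib)
  qed
  moreover have "hderiv n (smul0 c x) = smul0 c (hderiv n x)" for c x
  proof -
    have "Poly_Mapping.keys (smul0 c x) \<subseteq> Poly_Mapping.keys x"
      by (auto simp: in_keys_iff lookup_smul0)
    then show ?thesis
      by (simp add: hderiv_superset [of "Poly_Mapping.keys x"] lookup_smul0 V0.scale_sum_right)
        (simp add: smul0_def mult_single mult.left_commute)
  qed
  ultimately show ?thesis
    by (simp add: Vector_Spaces.linear_iff V0.vector_space_axioms)
qed

lemma linear_V_smul: "linear_V f \<Longrightarrow> linear_V (\<lambda>v. smul c (f v))"
  by (simp add: linear_V_iff V.scale_right_distrib V.scale_left_commute)

lemma linear_h_neg: "linear_V (h_neg n)"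
proof -
  have "Vector_Spaces.linear smul0 smul0 (\<lambda>f. hvar n * f)"
    by (simp add: Vector_Spaces.linear_iff V0.vector_space_axioms distrib_left smul0_mult_right)
  then show ?thesis unfolding h_neg_def [abs_def] by (rule linear_V_map)
qed

lemma linear_h_pos: "linear_V (h_pos \<alpha> n)"
proof -
  have "Vector_Spaces.linear smul0 smul0 (\<lambda>f. smul0 (inverse (of_nat \<alpha>) * of_nat n) (hderiv n f))"
    using linear_hderiv [of n]
    by (simp add: Vector_Spaces.linear_iff V0.scale_right_distrib V0.scale_left_commute)
  then show ?thesis unfolding h_pos_def [abs_def] by (rule linear_V_map)
qed

lemma linear_ser_pow:
  assumes "\<And>n. linear_V (a n)"
  shows "linear_V (ser_pow a k m)"
proof (induction k arbitrary: m)
  case 0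
  then show ?case by (simp add: linear_V_iff when_def)
next
  case (Suc k)
  then show ?case using assms
    by (simp add: linear_V_iff sum.distrib V.scale_sum_right)
qed

text \<open>Each factor raises the exponent of w by at least 1, so the k-th power starts in degree
  k. This makes the exponential a finite sum in each degree.\<close>

lemma ser_pow_eq_0:
  assumes "\<And>n. linear_V (a n)"
  shows "m < k \<Longrightarrow> ser_pow a k m v = 0"
  by (induction k arbitrary: m) (auto intro!: sum.neutral simp: linear_V_0 [OF assms])

lemma ser_exp_eq:
  assumes "\<And>n. linear_V (a n)"
  shows "ser_exp a m v = (\<Sum>k\<le>m. smul (1 / fact k) (ser_pow a k m v))"
  unfolding ser_exp_def
proof (rule Sum_any.expand_superset)
  show "{k. smul (1 / fact k) (ser_pow a k m v) \<noteq> 0} \<subseteq> {..m}"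
    using ser_pow_eq_0 [OF assms] by (force simp: not_less [symmetric])
qed simp

lemma linear_ser_exp:
  assumes "\<And>n. linear_V (a n)"
  shows "linear_V (ser_exp a m)"
  using linear_ser_pow [OF assms]
  by (simp add: linear_V_iff ser_exp_eq [OF assms] sum.distrib V.scale_right_distrib V.scale_sum_right
      V.scale_left_commute)

lemma linear_X_left: "linear_V (X_left \<alpha> p)"
  unfolding X_left_def by (intro linear_ser_exp linear_V_smul linear_h_neg)

lemma linear_X_right: "linear_V (X_right \<alpha> p)"
  unfolding X_right_def by (intro linear_ser_exp linear_V_smul linear_h_pos)

text \<open>With t = 2s the exponent (s + 1/2) 2 \<alpha> is the integer (t + 1) \<alpha>, and s + 1
  has label t + 2. This removes the rationals and the floor of \<open>tensor\<close>; the set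
  \<open>S\<close> serves additivity as in \<open>hderiv_superset\<close>.\<close>

lemma X_mid_superset:
  assumes "finite S" "Poly_Mapping.keys v \<subseteq> S"
  shows "X_mid \<alpha> j v = (\<Sum>t\<in>S. Poly_Mapping.single (t + 2) (Poly_Mapping.lookup v t)
     when (t + 1) * int \<alpha> = j)"
proof -
  have "(of_int t / 2 + 1 / 2) * 2 * of_nat \<alpha> = (of_int j :: rat) \<longleftrightarrow> (t + 1) * int \<alpha> = j" for t
  proof -
    have "(of_int t / 2 + 1 / 2) * 2 * of_nat \<alpha> = (of_int ((t + 1) * int \<alpha>) :: rat)"
      by (simp add: field_simps)
    then show ?thesis by (simp only: of_int_eq_iff)
  qed
  moreover have "\<lfloor>2 * (of_int t / 2 + 1 :: rat)\<rfloor> = t + 2" for t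
  proof -
    have "2 * (of_int t / 2 + 1 :: rat) = of_int (t + 2)" by simp
    then show ?thesis by (simp only: floor_of_int)
  qed
  ultimately have "X_mid \<alpha> j v = (\<Sum>t\<in>Poly_Mapping.keys v.
      Poly_Mapping.single (t + 2) (Poly_Mapping.lookup v t) when (t + 1) * int \<alpha> = j)"
    unfolding X_mid_def Let_def tensor_def by simp
  also have "\<dots> = (\<Sum>t\<in>S. Poly_Mapping.single (t + 2) (Poly_Mapping.lookup v t)
     when (t + 1) * int \<alpha> = j)"
    using assms by (intro sum.mono_neutral_left) (auto simp: in_keys_iff)
  finally show ?thesis .
qed

lemma linear_X_mid: "linear_V (X_mid \<alpha> j)"
proof -
  have "X_mid \<alpha> j (x + y) = X_mid \<alpha> j x + X_mid \<alpha> j y" for x y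
  proof -
    let ?S = "Poly_Mapping.keys x \<union> Poly_Mapping.keys y"
    have "Poly_Mapping.keys (x + y) \<subseteq> ?S" by (rule Poly_Mapping.keys_add)
    then show ?thesis
      by (simp add: X_mid_superset [of ?S] lookup_add single_add when_add_distrib sum.distrib)
  qed
  moreover have "X_mid \<alpha> j (smul c x) = smul c (X_mid \<alpha> j x)" for c x
  proof -
    have "Poly_Mapping.keys (smul c x) \<subseteq> Poly_Mapping.keys x"
      by (auto simp: in_keys_iff lookup_smul)
    then show ?thesis
      by (simp add: X_mid_superset [of "Poly_Mapping.keys x"] lookup_smul V.scale_sum_right when_def)
        (auto intro!: sum.cong simp: smul_single)
  qed
  ultimately show ?thesis
    by (simp add: linear_V_iff)
qed

lemma X_mid_single:
  "X_mid \<alpha> j (Poly_Mapping.single t f) = (Poly_Mapping.single (t + 2) f when (t + 1) * int \<alpha> = j)"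
  by (subst X_mid_superset [of "{t}"]) auto

section \<open>Finite supports and linearity of the coefficients of X(z)\<close>

definition X_term :: "nat \<Rightarrow> nat \<times> int \<times> nat \<Rightarrow> V \<Rightarrow> V" where
  "X_term \<alpha> = (\<lambda>(p, j, q) v. X_left \<alpha> p (X_mid \<alpha> j (X_right \<alpha> q v)))"

lemma linear_X_term: "linear_V (X_term \<alpha> x)"
  using linear_X_left linear_X_mid linear_X_right
  by (cases x) (simp add: X_term_def linear_V_iff)

text \<open>\<open>Sum_any\<close> takes the value 0 when the support is infinite, so
  \<open>X_op\<close> is not linear by its form alone. Finiteness of this set is carried along as a
  side condition.\<close>

definition X_supp :: "nat \<Rightarrow> int \<Rightarrow> V \<Rightarrow> (nat \<times> int \<times> nat) set" where
  "X_supp \<alpha> n v = {(p, j, q). int p + j - int q = - n \<and> X_term \<alpha> (p, j, q) v \<noteq> 0}"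

lemma X_op_eq_sum:
  assumes "finite A" "X_supp \<alpha> n v \<subseteq> A"
  shows "X_op \<alpha> n v = (\<Sum>(p, j, q)\<in>A. X_term \<alpha> (p, j, q) v when int p + j - int q = - n)"
  unfolding X_op_def X_term_def
  by (subst Sum_any.expand_superset [of A])
    (use assms in \<open>auto simp: X_supp_def X_term_def split: prod.splits\<close>)

text \<open>On the union of the finite supports every \<open>Sum_any\<close> becomes a finite sum
  over one index set, where linearity of \<open>X_term\<close> applies. The support of the
  combination lies in this union because a nonzero sum has a nonzero term.\<close>

lemma X_op_sum:
  assumes "finite I" "\<And>i. i \<in> I \<Longrightarrow> finite (X_supp \<alpha> n (v i))"
  shows "X_op \<alpha> n (\<Sum>i\<in>I. smul (c i) (v i)) = (\<Sum>i\<in>I. smul (c i) (X_op \<alpha> n (v i)))"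
proof -
  let ?A = "\<Union>i\<in>I. X_supp \<alpha> n (v i)"
  let ?v = "\<Sum>i\<in>I. smul (c i) (v i)"
  have fin: "finite ?A" using assms by blast
  have lin: "X_term \<alpha> x ?v = (\<Sum>i\<in>I. smul (c i) (X_term \<alpha> x (v i)))" for x
    by (simp add: linear_V_sum [OF linear_X_term] linear_V_scale [OF linear_X_term])
  have "X_supp \<alpha> n ?v \<subseteq> ?A"
  proof
    fix x assume x: "x \<in> X_supp \<alpha> n ?v"
    then have "X_term \<alpha> x ?v \<noteq> 0" by (auto simp: X_supp_def)
    then obtain i where "i \<in> I" "smul (c i) (X_term \<alpha> x (v i)) \<noteq> 0"
      unfolding lin by (rule sum.not_neutral_contains_not_neutral)
    with x show "x \<in> ?A" by (auto simp: X_supp_def)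
  qed
  then have "X_op \<alpha> n ?v = (\<Sum>(p, j, q)\<in>?A. X_term \<alpha> (p, j, q) ?v when int p + j - int q = - n)"
    by (rule X_op_eq_sum [OF fin])
  also have "\<dots> = (\<Sum>x\<in>?A. \<Sum>i\<in>I. smul (c i)
      (case x of (p, j, q) \<Rightarrow> X_term \<alpha> (p, j, q) (v i) when int p + j - int q = - n))"
    unfolding lin by (intro sum.cong refl) (auto simp: when_def)
  also have "\<dots> = (\<Sum>i\<in>I. smul (c i)
      (\<Sum>(p, j, q)\<in>?A. X_term \<alpha> (p, j, q) (v i) when int p + j - int q = - n))"
    by (subst sum.swap) (simp add: V.scale_sum_right)
  also have "\<dots> = (\<Sum>i\<in>I. smul (c i) (X_op \<alpha> n (v i)))"
    by (intro sum.cong refl) (subst X_op_eq_sum [OF fin], auto)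
  finally show ?thesis .
qed

subsection \<open>Exponentials as sums over partitions\<close>

definition mset_fact :: "nat multiset \<Rightarrow> nat" where
  "mset_fact p = (\<Prod>i\<in>set_mset p. fact (count p i))"

lemma mset_fact_empty [simp]: "mset_fact {#} = 1"
  by (simp add: mset_fact_def)

lemma mset_fact_nonzero [simp]: "mset_fact p \<noteq> 0"
  by (simp add: mset_fact_def)

lemma mset_fact_add_mset: "mset_fact (add_mset n p) = Suc (count p n) * mset_fact p"
proof -
  let ?S = "insert n (set_mset p)" and ?P = "set_mset p - {n}"
  have S: "?S = insert n ?P" by auto
  have "mset_fact p = (\<Prod>i\<in>?S. fact (count p i))"
    unfolding mset_fact_def by (rule prod.mono_neutral_left) (auto simp: not_in_iff)
  also have "\<dots> = fact (count p n) * (\<Prod>i\<in>?P. fact (count p i))"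
    unfolding S by (subst prod.insert) auto
  finally have p: "mset_fact p = fact (count p n) * (\<Prod>i\<in>?P. fact (count p i))" .
  have "mset_fact (add_mset n p) = (\<Prod>i\<in>insert n ?P. fact (count (add_mset n p) i))"
    unfolding mset_fact_def set_mset_add_mset_insert S [symmetric] ..
  also have "\<dots> = fact (Suc (count p n)) * (\<Prod>i\<in>?P. fact (count p i))"
    by (subst prod.insert) (auto intro!: prod.cong)
  finally show ?thesis by (simp add: p algebra_simps)
qed

text \<open>The two factors have different origins: \<open>prod_mset p\<close> collects the
  denominators n of the series in the exponent, and \<open>mset_fact p\<close> comes from the
  multinomial coefficients.\<close>

lemma zee_eq: "zee p = prod_mset p * mset_fact p"
  by (simp add: zee_def mset_fact_def prod.distrib prod_mset_multiplicity)

lemma size_le_sum_mset: "p \<in> partitions \<Longrightarrow> size p \<le> sum_mset p"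
  by (induction p) (auto simp: partitions_def)

text \<open>A partition of m has at most m parts, each at most m, so it is the multiset of one of
  finitely many lists.\<close>

lemma finite_partitions_sum: "finite {p \<in> partitions. sum_mset p = m}"
proof -
  have "{p \<in> partitions. sum_mset p = m} \<subseteq> mset ` {xs. set xs \<subseteq> {..m} \<and> length xs \<le> m}"
  proof
    fix p assume "p \<in> {p \<in> partitions. sum_mset p = m}"
    then have p: "p \<in> partitions" "sum_mset p = m" by auto
    obtain xs where xs: "mset xs = p" using ex_mset by blast
    have "set xs \<subseteq> {..m}"
      using p(2) xs by (auto simp: sum_mset_sum_list intro: member_le_sum_list)
    then show "p \<in> mset ` {xs. set xs \<subseteq> {..m} \<and> length xs \<le> m}"
      using size_le_sum_mset [OF p(1)] p(2) xs by (auto intro!: image_eqI [of _ _ xs])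
  qed
  then show ?thesis
    by (rule finite_subset) (intro finite_imageI finite_lists_length_le finite_atMost)
qed

lemma partitions_add_mset [simp]: "add_mset n p \<in> partitions \<longleftrightarrow> n > 0 \<and> p \<in> partitions"
  by (auto simp: partitions_def)

lemma partitions_empty [simp]: "{#} \<in> partitions"
  by (simp add: partitions_def)

lemma partitions_subset: "p \<in> partitions \<Longrightarrow> q \<subseteq># p \<Longrightarrow> q \<in> partitions"
  by (auto simp: partitions_def dest: mset_subset_eqD)

lemma partitions_union [simp]: "p + q \<in> partitions \<longleftrightarrow> p \<in> partitions \<and> q \<in> partitions"
  by (auto simp: partitions_def)

lemma partitions_diff: "p \<in> partitions \<Longrightarrow> p - q \<in> partitions"
  by (auto simp: partitions_def dest: in_diffD)

text \<open>The multinomial theorem: if \<open>W p\<close> is the result of applying \<open>a n\<close> to \<open>v\<close> for all \<open>n \<in># p\<close>,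
  then the \<open>k! / mset_fact p\<close> arrangements of \<open>p\<close> all contribute the same vector \<open>W p\<close>.\<close>

lemma ser_pow_eq_sum_partitions:
  assumes lin: "\<And>n. linear_V (a n)"
    and W0: "W {#} = v"
    and W_add: "\<And>n p. n > 0 \<Longrightarrow> p \<in> partitions \<Longrightarrow> a n (W p) = W (add_mset n p)"
  shows "ser_pow a k m v =
    (\<Sum>p\<in>{p \<in> partitions. sum_mset p = m \<and> size p = k}. smul (fact k / of_nat (mset_fact p)) (W p))"
proof (induction k arbitrary: m)
  case 0
  have "{p \<in> partitions. sum_mset p = m \<and> size p = 0} = (if m = 0 then {{#}} else {})" by auto
  then show ?case by (auto simp: W0 when_def)
next
  case (Suc k)
  let ?P = "\<lambda>m k. {p \<in> partitions. sum_mset p = m \<and> size p = k}"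
  have fin: "finite (?P m k)" for m k
    by (rule finite_subset [OF _ finite_partitions_sum [of m]]) auto
  let ?c = "\<lambda>p n. of_nat (count p n) * (fact k / of_nat (mset_fact p)) :: complex"
  have "ser_pow a (Suc k) m v =
      (\<Sum>n=1..m. \<Sum>p\<in>?P (m - n) k. smul (fact k / of_nat (mset_fact p)) (W (add_mset n p)))"
    by (auto simp: Suc linear_V_sum [OF lin] linear_V_scale [OF lin] W_add intro!: sum.cong)
  also have "\<dots> = (\<Sum>(n, p)\<in>Sigma {1..m} (\<lambda>n. ?P (m - n) k).
      smul (fact k / of_nat (mset_fact p)) (W (add_mset n p)))"
    by (rule sum.Sigma) (auto intro: fin)
  \<comment> \<open>An outermost factor n together with the remaining partition corresponds to a
    partition of size k + 1 with a chosen part value n. By \<open>mset_fact_add_mset\<close>, the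
    multiplicity of n in \<open>?c\<close> makes up for the change of
    \<open>mset_fact\<close>.\<close>
  also have "\<dots> = (\<Sum>(p, n)\<in>Sigma (?P m (Suc k)) set_mset. smul (?c p n) (W p))"
  proof (rule sum.reindex_bij_witness [where i = "\<lambda>(p, n). (n, p - {#n#})" and j = "\<lambda>(n, p). (add_mset n p, n)"])
    fix x assume "x \<in> Sigma (?P m (Suc k)) set_mset"
    then obtain p n where x: "x = (p, n)" "n \<in># p" "p \<in> partitions" "sum_mset p = m" "size p = Suc k"
      by auto
    then obtain q where q: "p = add_mset n q" by (metis insert_DiffM)
    show "(case case x of (p, n) \<Rightarrow> (n, p - {#n#}) of (n, p) \<Rightarrow> (add_mset n p, n)) = x"
      using x q by simp
    show "(case x of (p, n) \<Rightarrow> (n, p - {#n#})) \<in> Sigma {1..m} (\<lambda>n. ?P (m - n) k)"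
      using x q by auto
  next
    fix x assume "x \<in> Sigma {1..m} (\<lambda>n. ?P (m - n) k)"
    then obtain n p where x: "x = (n, p)" "1 \<le> n" "n \<le> m" "p \<in> partitions" "sum_mset p = m - n" "size p = k"
      by auto
    show "(case case x of (n, p) \<Rightarrow> (add_mset n p, n) of (p, n) \<Rightarrow> (n, p - {#n#})) = x"
      using x by simp
    show "(case x of (n, p) \<Rightarrow> (add_mset n p, n)) \<in> Sigma (?P m (Suc k)) set_mset"
      using x by auto
    show "(case case x of (n, p) \<Rightarrow> (add_mset n p, n) of (p, n) \<Rightarrow> smul (?c p n) (W p)) =
        (case x of (n, p) \<Rightarrow> smul (fact k / of_nat (mset_fact p)) (W (add_mset n p)))"
      using x by (simp add: mset_fact_add_mset del: of_nat_Suc mult_Suc)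
  qed
  also have "\<dots> = (\<Sum>p\<in>?P m (Suc k). \<Sum>n\<in>set_mset p. smul (?c p n) (W p))"
    by (rule sum.Sigma [symmetric]) (auto intro: fin)
  also have "\<dots> = (\<Sum>p\<in>?P m (Suc k). smul (fact (Suc k) / of_nat (mset_fact p)) (W p))"
  proof (rule sum.cong [OF refl])
    fix p assume p: "p \<in> ?P m (Suc k)"
    \<comment> \<open>The multiplicities add up to the size k + 1, which turns k! into (k +
      1)!.\<close>
    have "(\<Sum>n\<in>set_mset p. of_nat (count p n)) = (of_nat (Suc k) :: complex)"
      using p by (simp add: size_multiset_overloaded_eq flip: of_nat_sum)
    then have "(\<Sum>n\<in>set_mset p. ?c p n) = fact (Suc k) / of_nat (mset_fact p)"
      by (simp flip: sum_distrib_right sum_divide_distrib del: of_nat_Suc)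
    then show "(\<Sum>n\<in>set_mset p. smul (?c p n) (W p)) = smul (fact (Suc k) / of_nat (mset_fact p)) (W p)"
      by (simp flip: V.scale_sum_left)
  qed
  finally show ?case .
qed

text \<open>The factor 1 / k! of the exponential cancels the k! of the multinomial theorem. A
  partition of m has at most m parts, so grouping by size \<open>k \<le> m\<close> exhausts all of
  them.\<close>

lemma ser_exp_eq_sum_partitions:
  assumes lin: "\<And>n. linear_V (a n)"
    and W0: "W {#} = v"
    and W_add: "\<And>n p. n > 0 \<Longrightarrow> p \<in> partitions \<Longrightarrow> a n (W p) = W (add_mset n p)"
  shows "ser_exp a m v =
    (\<Sum>p\<in>{p \<in> partitions. sum_mset p = m}. smul (1 / of_nat (mset_fact p)) (W p))"
proof -
  let ?P = "{p \<in> partitions. sum_mset p = m}"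
  have "ser_exp a m v = (\<Sum>k\<le>m. \<Sum>p\<in>{p \<in> ?P. size p = k}. smul (1 / of_nat (mset_fact p)) (W p))"
    unfolding ser_exp_eq [OF lin]
    by (subst ser_pow_eq_sum_partitions [where a = a and W = W, OF assms])
      (simp_all add: V.scale_sum_right conj_assoc)
  also have "\<dots> = (\<Sum>p\<in>?P. smul (1 / of_nat (mset_fact p)) (W p))"
    by (rule sum.group) (auto simp: finite_partitions_sum size_le_sum_mset)
  finally show ?thesis .
qed

section \<open>The two exponentials applied to monomials\<close>

lemma X_left_single:
  "X_left \<alpha> p (Poly_Mapping.single t f) = (\<Sum>q\<in>{q \<in> partitions. sum_mset q = p}.
     Poly_Mapping.single t (smul0 (of_nat \<alpha> ^ size q / of_nat (zee q)) (hmono q * f)))"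
  (is "_ = ?R")
proof -
  \<comment> \<open>Each part n of q contributes the scalar \<alpha> / n and one variable
    \<open>hvar n\<close>.\<close>
  let ?W = "\<lambda>q. Poly_Mapping.single t (smul0 (of_nat \<alpha> ^ size q / of_nat (prod_mset q)) (hmono q * f))"
  have "X_left \<alpha> p (Poly_Mapping.single t f) =
      (\<Sum>q\<in>{q \<in> partitions. sum_mset q = p}. smul (1 / of_nat (mset_fact q)) (?W q))"
    unfolding X_left_def
  proof (rule ser_exp_eq_sum_partitions)
    show "linear_V (\<lambda>v. smul (of_nat \<alpha> / of_nat n) (h_neg n v))" for n
      by (intro linear_V_smul linear_h_neg)
    show "?W {#} = Poly_Mapping.single t f"
      by (simp add: hmono_def)
    show "smul (of_nat \<alpha> / of_nat n) (h_neg n (?W q)) = ?W (add_mset n q)" for n q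
      by (simp add: h_neg_def smul_single hmono_def smul0_mult_right mult.assoc)
  qed
  also have "\<dots> = ?R"
    by (simp add: smul_single zee_eq mult.commute)
  finally show ?thesis .
qed

lemma hmono_empty [simp]: "hmono {#} = 1"
  by (simp add: hmono_def)

lemma hmono_add_mset: "hmono (add_mset n p) = hvar n * hmono p"
  by (simp add: hmono_def)

lemma hmono_union: "hmono (p + q) = hmono p * hmono q"
  by (simp add: hmono_def)

text \<open>Positivity of the parts matters: under truncated subtraction \<open>hvar 0\<close>
  coincides with \<open>hvar 1\<close>, and the exponent at index 0 would count both.\<close>

lemma hmono_eq_single:
  assumes "p \<in> partitions"
  shows "\<exists>e. hmono p = Poly_Mapping.single e 1 \<and> (\<forall>n>0. Poly_Mapping.lookup e (n - 1) = count p n)"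
  using assms
proof (induction p)
  case empty
  show ?case by (rule exI [of _ 0]) simp
next
  case (add n p)
  then obtain e where e: "hmono p = Poly_Mapping.single e 1"
    "\<And>n. n > 0 \<Longrightarrow> Poly_Mapping.lookup e (n - 1) = count p n" and n: "n > 0"
    by auto
  have "Poly_Mapping.lookup (Poly_Mapping.single (n - 1) 1 + e) (k - 1) = count (add_mset n p) k"
    if "k > 0" for k
  proof -
    have "n - 1 = k - 1 \<longleftrightarrow> n = k" using that n by auto
    then show ?thesis using e(2) [OF that] by (simp add: lookup_add lookup_single when_def)
  qed
  then show ?case
    by (intro exI [of _ "Poly_Mapping.single (n - 1) 1 + e"])
      (simp add: hmono_add_mset e(1) hvar_def mult_single)
qed

lemma hderiv_hmono:
  assumes "p \<in> partitions" "n > 0"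
  shows "hderiv n (hmono p) = smul0 (of_nat (count p n)) (hmono (p - {#n#}))"
proof (cases "n \<in># p")
  case True
  then obtain q where q: "p = add_mset n q" by (metis insert_DiffM)
  with assms have "q \<in> partitions" by simp
  then obtain e where e: "hmono q = Poly_Mapping.single e 1"
    "\<And>n. n > 0 \<Longrightarrow> Poly_Mapping.lookup e (n - 1) = count q n"
    using hmono_eq_single by blast
  show ?thesis
    using e(2) [OF \<open>n > 0\<close>]
    by (simp add: q hmono_add_mset e(1) hvar_def mult_single hderiv_def smul0_def lookup_add)
next
  case False
  obtain e where e: "hmono p = Poly_Mapping.single e 1"
    "\<And>n. n > 0 \<Longrightarrow> Poly_Mapping.lookup e (n - 1) = count p n"
    using hmono_eq_single assms(1) by blast
  show ?thesis
    using e(2) [OF \<open>n > 0\<close>] False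
    by (simp add: e(1) hderiv_def not_in_iff)
qed

text \<open>The number \<open>mset_fact q * mbinom p q\<close> is a product of falling factorials,
  the coefficient produced by differentiating \<open>hmono p\<close> once for each part of q. One
  more derivative brings in the next factor.\<close>

lemma mset_fact_mbinom_add_mset:
  assumes "add_mset n q \<subseteq># p"
  shows "mset_fact (add_mset n q) * mbinom p (add_mset n q) =
    (count p n - count q n) * (mset_fact q * mbinom p q)"
proof -
  let ?S = "set_mset p - {n}"
  let ?R = "\<Prod>i\<in>?S. count p i choose count q i"
  have n: "n \<in># p" using assms by (auto dest: mset_subset_eqD)
  then have S: "set_mset p = insert n ?S" by auto
  have rest: "(\<Prod>i\<in>?S. count p i choose count (add_mset n q) i) = ?R"
    by (intro prod.cong) auto
  have m: "mbinom p r = (count p n choose count r n) * (\<Prod>i\<in>?S. count p i choose count r i)" for r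
    unfolding mbinom_def by (subst S, subst prod.insert) auto
  have "Suc (count q n) * (count p n choose Suc (count q n)) =
      (count p n - count q n) * (count p n choose count q n)"
    by (metis binomial_absorb_comp binomial_absorption diff_Suc_1 mult.commute)
  then have "Suc (count q n) * (count p n choose Suc (count q n)) * (mset_fact q * ?R) =
      (count p n - count q n) * (count p n choose count q n) * (mset_fact q * ?R)"
    by (simp only:)
  then show ?thesis
    unfolding m [of q] m [of "add_mset n q"] rest mset_fact_add_mset
    by (simp only: count_add_mset if_True refl mult.assoc mult.left_commute mult.commute)
qed

lemma X_right_single_hmono:
  assumes "\<alpha> > 0" "p \<in> partitions"
  shows "X_right \<alpha> m (Poly_Mapping.single t (hmono p)) =
    (\<Sum>q\<in>{q. q \<subseteq># p \<and> sum_mset q = m}.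
       Poly_Mapping.single t (smul0 ((- 2) ^ size q * of_nat (mbinom p q)) (hmono (p - q))))"
    (is "_ = ?R")
proof -
  \<comment> \<open>These are the iterated derivatives of \<open>hmono p\<close>. The guard supplies
    the value 0 when q has too many copies of a part: \<open>p - q\<close> is truncated, and
    \<open>mbinom p q\<close> has no factor at parts outside p.\<close>
  let ?W = "\<lambda>q. Poly_Mapping.single t
     (smul0 ((- 2) ^ size q * of_nat (mset_fact q * mbinom p q)) (hmono (p - q))) when q \<subseteq># p"
  have "X_right \<alpha> m (Poly_Mapping.single t (hmono p)) =
      (\<Sum>q\<in>{q \<in> partitions. sum_mset q = m}. smul (1 / of_nat (mset_fact q)) (?W q))"
    unfolding X_right_def
  proof (rule ser_exp_eq_sum_partitions)
    show "linear_V (\<lambda>v. smul (2 * of_nat \<alpha> / - of_nat n) (h_pos \<alpha> n v))" for n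
      by (intro linear_V_smul linear_h_pos)
    show "?W {#} = Poly_Mapping.single t (hmono p)"
      by (simp add: mbinom_def)
    fix n :: nat and q assume n: "n > 0" and "q \<in> partitions"
    have scale: "hderiv n (smul0 c f) = smul0 c (hderiv n f)" for c f
      using linear_hderiv [of n] by (simp add: Vector_Spaces.linear_iff)
    have zero: "hderiv n 0 = 0" by (simp add: hderiv_def)
    show "smul (2 * of_nat \<alpha> / - of_nat n) (h_pos \<alpha> n (?W q)) = ?W (add_mset n q)"
    proof (cases "q \<subseteq># p")
      case True
      \<comment> \<open>The scalars 2 \<alpha> / (-n) and n / \<alpha> multiply to -2, and the
        derivative brings down the multiplicity of n in \<open>p - q\<close>.\<close>
      have "smul (2 * of_nat \<alpha> / - of_nat n) (h_pos \<alpha> n (?W q)) =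
          Poly_Mapping.single t (smul0 ((- 2) ^ size (add_mset n q) *
            of_nat ((count p n - count q n) * (mset_fact q * mbinom p q))) (hmono (p - add_mset n q)))"
        using True n \<open>\<alpha> > 0\<close>
        by (simp add: h_pos_def smul_single scale hderiv_hmono partitions_diff [OF assms(2)] zero
            field_simps)
      also have "\<dots> = ?W (add_mset n q)"
      proof (cases "add_mset n q \<subseteq># p")
        assume "add_mset n q \<subseteq># p"
        then show ?thesis by (simp only: mset_fact_mbinom_add_mset when_simps)
      next
        \<comment> \<open>Here q already uses up all copies of n in p, so the falling factor is 0,
          in agreement with the guard.\<close>
        assume False: "\<not> add_mset n q \<subseteq># p"
        have "add_mset n q \<subseteq># p" if "count q n < count p n"
          by (rule mset_subset_eqI) (use that mset_subset_eq_count [OF True] in \<open>auto simp: Suc_le_eq\<close>)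
        with False have "count p n \<le> count q n" by (meson not_less)
        then show ?thesis using False by simp
      qed
      finally show ?thesis .
    next
      case False
      moreover from False have "\<not> add_mset n q \<subseteq># p"
        using subset_mset.trans [OF mset_subset_eq_add_right [of q "{#n#}"]] by auto
      ultimately show ?thesis by (simp add: linear_V_0 [OF linear_h_pos])
    qed
  qed
  also have "\<dots> = (\<Sum>q\<in>{q. q \<subseteq># p \<and> sum_mset q = m}. smul (1 / of_nat (mset_fact q)) (?W q))"
    using partitions_subset [OF assms(2)]
    by (intro sum.mono_neutral_right) (auto simp: finite_partitions_sum)
  also have "\<dots> = ?R"
    by (intro sum.cong refl) (auto simp: smul_single)
  finally show ?thesis .
qed

subsection \<open>One application of the vertex operator\<close>

text \<open>The derivatives give a binomial in the removed parts, whereas the theorem uses the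
  surviving parts; symmetry of binomial coefficients reconciles the two.\<close>

lemma mbinom_diff: "q \<subseteq># p \<Longrightarrow> mbinom p (p - q) = mbinom p q"
  unfolding mbinom_def
  by (intro prod.cong refl) (metis binomial_symmetric count_diff mset_subset_eq_count)

text \<open>This normalisation cancels the powers of \<open>-2\<close> produced by the derivatives and turns \<open>\<alpha>\<close> into
  \<open>-2 \<alpha>\<close> in the first exponential.\<close>

definition nmono :: "nat multiset \<Rightarrow> V0" where
  "nmono p = smul0 (1 / (- 2) ^ size p) (hmono p)"

text \<open>The i-th factor of the product in the theorem, with p, p' and r in the roles of
  \<open>\<mu> (i - 1)\<close>, \<open>\<mu> i\<close> and \<open>\<nu> i\<close>.\<close>

definition step_coeff :: "nat \<Rightarrow> nat multiset \<Rightarrow> nat multiset \<Rightarrow> nat multiset \<Rightarrow> complex" where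
  "step_coeff \<alpha> p p' r =
     (- 2 * of_nat \<alpha>) ^ size r / of_nat (zee r) * of_nat (mbinom p (p' - r))"

text \<open>The choices for one step from p, where t is twice the exponent of the current basis
  element. The weight condition is relative to p, so that no earlier steps enter.\<close>

definition step_index ::
  "nat \<Rightarrow> int \<Rightarrow> nat \<Rightarrow> nat multiset \<Rightarrow> (nat multiset \<times> nat multiset) set" where
  "step_index \<alpha> t k p = {(p', r). p' \<in> partitions \<and> r \<in> partitions \<and> r \<subseteq># p' \<and> p' - r \<subseteq># p \<and>
     int (sum_mset p') = int (sum_mset p) + int k - (t + 1) * int \<alpha>}"

lemma finite_mset_subsets: "finite {q. q \<subseteq># p}"
proof (induction p)
  case empty
  then show ?case by simp
next
  case (add x p)
  have "{q. q \<subseteq># add_mset x p} \<subseteq> {q. q \<subseteq># p} \<union> add_mset x ` {q. q \<subseteq># p}"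
  proof
    fix q assume q: "q \<in> {q. q \<subseteq># add_mset x p}"
    show "q \<in> {q. q \<subseteq># p} \<union> add_mset x ` {q. q \<subseteq># p}"
    proof (cases "x \<in># q")
      case True
      then obtain r where "q = add_mset x r" by (metis insert_DiffM)
      with q show ?thesis by auto
    next
      case False
      with q show ?thesis by (metis UnI1 add_mset_add_single diff_single_trivial mem_Collect_eq subset_eq_diff_conv)
    qed
  qed
  with add show ?case by (meson finite_UnI finite_imageI finite_subset)
qed

lemma finite_step_index: "finite (step_index \<alpha> t k p)"
proof -
  let ?m = "nat (int (sum_mset p) + int k - (t + 1) * int \<alpha>)"
  have "step_index \<alpha> t k p \<subseteq> Sigma {p \<in> partitions. sum_mset p = ?m} (\<lambda>p. {r. r \<subseteq># p})"
    by (auto simp: step_index_def simp del: of_nat_sum_mset)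
  then show ?thesis
    by (rule finite_subset) (intro finite_SigmaI finite_partitions_sum finite_mset_subsets)
qed

text \<open>The derivatives remove q from p, and the first exponential multiplies in r, which leaves
  the partition r + (p - q). The middle factor admits a single exponent.\<close>

lemma X_term_single_nmono:
  assumes "\<alpha> > 0" "p \<in> partitions"
  shows "X_term \<alpha> (a, j, b) (Poly_Mapping.single t (nmono p)) =
    (\<Sum>(r, q)\<in>{(r, q). r \<in> partitions \<and> sum_mset r = a \<and> q \<subseteq># p \<and> sum_mset q = b}.
       smul (step_coeff \<alpha> p (r + (p - q)) r) (Poly_Mapping.single (t + 2) (nmono (r + (p - q))))
         when (t + 1) * int \<alpha> = j)" (is "_ = (\<Sum>(r, q)\<in>?I. ?F r q when _)")
proof -
  let ?Q = "{q. q \<subseteq># p \<and> sum_mset q = b}" and ?R = "{r \<in> partitions. sum_mset r = a}"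
  let ?b = "\<lambda>q. (- 2) ^ size q * of_nat (mbinom p q) :: complex"
  let ?c = "\<lambda>r. of_nat \<alpha> ^ size r / of_nat (zee r) :: complex"
  \<comment> \<open>Removing q leaves the normalisation of p - q. Passing to that of r + (p - q)
    costs (-2) to the power \<open>size r\<close>, which is absorbed by turning \<alpha> into -2
    \<alpha>.\<close>
  have coeff: "1 / (- 2) ^ size p * (?b q * ?c r) =
      step_coeff \<alpha> p (r + (p - q)) r * (1 / (- 2) ^ size (r + (p - q)))" if q: "q \<subseteq># p" for q r
  proof -
    from q obtain q' where p: "p = q + q'" unfolding mset_subset_eq_exists_conv by blast
    have "(- 2 * of_nat \<alpha> :: complex) ^ size r = (- 2) ^ size r * of_nat \<alpha> ^ size r"
      by (rule power_mult_distrib)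
    then show ?thesis
      using mbinom_diff [OF q]
      by (simp only: step_coeff_def) (simp add: p power_add field_simps)
  qed
  have summand: "smul (1 / (- 2) ^ size p)
      (smul (?b q * ?c r) (Poly_Mapping.single (t + 2) (hmono (r + (p - q))))) = ?F r q"
    if "q \<subseteq># p" for q r
    by (simp only: nmono_def V.scale_scale coeff [OF that] flip: smul_single)
  have "X_term \<alpha> (a, j, b) (Poly_Mapping.single t (nmono p)) =
    smul (1 / (- 2) ^ size p) (X_term \<alpha> (a, j, b) (Poly_Mapping.single t (hmono p)))"
    by (simp add: nmono_def linear_V_scale [OF linear_X_term] flip: smul_single)
  also have "X_term \<alpha> (a, j, b) (Poly_Mapping.single t (hmono p)) =
    (\<Sum>q\<in>?Q. X_left \<alpha> a (X_mid \<alpha> j (Poly_Mapping.single t (smul0 (?b q) (hmono (p - q))))))"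
    unfolding X_term_def prod.case X_right_single_hmono [OF assms]
      linear_V_sum [OF linear_X_mid] linear_V_sum [OF linear_X_left] ..
  also have "\<dots> = (\<Sum>q\<in>?Q. \<Sum>r\<in>?R. smul (?b q * ?c r)
      (Poly_Mapping.single (t + 2) (hmono (r + (p - q)))) when (t + 1) * int \<alpha> = j)"
    unfolding hmono_union
    by (intro sum.cong refl)
      (simp add: X_mid_single when_def linear_V_0 [OF linear_X_left] X_left_single smul_single
        smul0_mult_right mult.commute)
  also have "smul (1 / (- 2) ^ size p) \<dots> = (\<Sum>q\<in>?Q. \<Sum>r\<in>?R. ?F r q when (t + 1) * int \<alpha> = j)"
    unfolding V.scale_sum_right
    by (intro sum.cong refl, cases "(t + 1) * int \<alpha> = j")
      (simp_all only: when_def if_True if_False simp_thms V.scale_zero_right mem_Collect_eq summand)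
  also have "\<dots> = (\<Sum>r\<in>?R. \<Sum>q\<in>?Q. ?F r q when (t + 1) * int \<alpha> = j)"
    by (rule sum.swap)
  also have "\<dots> = (\<Sum>(r, q)\<in>?R \<times> ?Q. ?F r q when (t + 1) * int \<alpha> = j)"
    by (rule sum.cartesian_product)
  also have "?R \<times> ?Q = ?I" by auto
  finally show ?thesis .
qed

lemma X_op_single_nmono:
  assumes "\<alpha> > 0" "p \<in> partitions"
  shows "finite (X_supp \<alpha> (- int k) (Poly_Mapping.single t (nmono p)))" (is ?fin)
    and "X_op \<alpha> (- int k) (Poly_Mapping.single t (nmono p)) =
      (\<Sum>(p', r)\<in>step_index \<alpha> t k p.
         smul (step_coeff \<alpha> p p' r) (Poly_Mapping.single (t + 2) (nmono p')))" (is ?eq)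
proof -
  let ?v = "Poly_Mapping.single t (nmono p)" and ?S = "step_index \<alpha> t k p"
  let ?F = "\<lambda>(p', r). smul (step_coeff \<alpha> p p' r) (Poly_Mapping.single (t + 2) (nmono p'))"
  \<comment> \<open>A pair (p', r) arises from exactly one triple of exponents: r comes from the
    first factor, and p - (p' - r) is what the derivatives removed. The sum over
    \<open>step_index\<close> is split along the fibres of \<open>?g\<close>.\<close>
  let ?g = "\<lambda>(p', r). (sum_mset r, (t + 1) * int \<alpha>, sum_mset (p - (p' - r)))"
  have terms: "(X_term \<alpha> (a, j, b) ?v when int a + j - int b = - (- int k)) =
      (\<Sum>x\<in>{x \<in> ?S. ?g x = (a, j, b)}. ?F x)" for a j b
  proof (cases "int a + j - int b = int k \<and> (t + 1) * int \<alpha> = j")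
    case True
    let ?I = "{(r, q). r \<in> partitions \<and> sum_mset r = a \<and> q \<subseteq># p \<and> sum_mset q = b}"
    have "X_term \<alpha> (a, j, b) ?v = (\<Sum>(r, q)\<in>?I. ?F (r + (p - q), r))"
      using True by (simp add: X_term_single_nmono [OF assms])
    also have "\<dots> = (\<Sum>x\<in>{x \<in> ?S. ?g x = (a, j, b)}. ?F x)"
    proof (rule sum.reindex_bij_witness [where i = "\<lambda>(p', r). (r, p - (p' - r))"
          and j = "\<lambda>(r, q). (r + (p - q), r)"])
      fix x assume "x \<in> ?I"
      then obtain r q where x: "x = (r, q)" "r \<in> partitions" "sum_mset r = a" "q \<subseteq># p" "sum_mset q = b"
        by auto
      from x(4) obtain q' where p: "p = q + q'" unfolding mset_subset_eq_exists_conv by blast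
      show "(case case x of (r, q) \<Rightarrow> (r + (p - q), r) of (p', r) \<Rightarrow> (r, p - (p' - r))) = x"
        using x p by simp
      show "(case x of (r, q) \<Rightarrow> (r + (p - q), r)) \<in> {x \<in> ?S. ?g x = (a, j, b)}"
        using x p True assms(2) by (auto simp: step_index_def)
      show "?F (case x of (r, q) \<Rightarrow> (r + (p - q), r)) = (case x of (r, q) \<Rightarrow> ?F (r + (p - q), r))"
        using x by simp
    next
      fix x assume "x \<in> {x \<in> ?S. ?g x = (a, j, b)}"
      then obtain p' r where x: "x = (p', r)" "r \<in> partitions" "r \<subseteq># p'" "p' - r \<subseteq># p"
        "sum_mset r = a" "sum_mset (p - (p' - r)) = b"
        by (auto simp: step_index_def)
      from \<open>r \<subseteq># p'\<close> obtain q' where p': "p' = r + q'" unfolding mset_subset_eq_exists_conv by blast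
      with x have "q' \<subseteq># p" by simp
      then obtain q where p: "p = q' + q" unfolding mset_subset_eq_exists_conv by blast
      show "(case case x of (p', r) \<Rightarrow> (r, p - (p' - r)) of (r, q) \<Rightarrow> (r + (p - q), r)) = x"
        using x by (simp add: p p')
      show "(case x of (p', r) \<Rightarrow> (r, p - (p' - r))) \<in> ?I"
        using x by (simp add: p p')
    qed
    finally show ?thesis using True by simp
  next
    case False
    \<comment> \<open>The weight equation in \<open>step_index\<close> forces the exponents in
      \<open>?g x\<close> to combine to k, so every other triple has an empty fibre.\<close>
    have "x \<notin> ?S" if "?g x = (a, j, b)" for x
    proof
      assume "x \<in> ?S"
      with that obtain p' r where x: "r \<subseteq># p'" "p' - r \<subseteq># p"
        "int (sum_mset p') = int (sum_mset p) + int k - (t + 1) * int \<alpha>"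
        "sum_mset r = a" "sum_mset (p - (p' - r)) = b" "(t + 1) * int \<alpha> = j"
        by (auto simp: step_index_def)
      from \<open>r \<subseteq># p'\<close> obtain q' where p': "p' = r + q'" unfolding mset_subset_eq_exists_conv by blast
      with x have "q' \<subseteq># p" by simp
      then obtain q where p: "p = q' + q" unfolding mset_subset_eq_exists_conv by blast
      show False using False x by (auto simp: p p')
    qed
    then have "{x \<in> ?S. ?g x = (a, j, b)} = {}" by blast
    moreover have "(X_term \<alpha> (a, j, b) ?v when int a + j - int b = - (- int k)) = 0"
      using False by (auto simp: X_term_single_nmono [OF assms] when_def intro!: sum.neutral)
    ultimately show ?thesis by (simp only: sum.empty)
  qed
  \<comment> \<open>A nonzero term has a nonempty fibre, which places the support inside the finite
    image of \<open>?g\<close>.\<close>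
  have sub: "X_supp \<alpha> (- int k) ?v \<subseteq> ?g ` ?S"
  proof
    fix x assume x: "x \<in> X_supp \<alpha> (- int k) ?v"
    obtain a j b where abj: "x = (a, j, b)" by (cases x) auto
    with x have "(X_term \<alpha> (a, j, b) ?v when int a + j - int b = - (- int k)) \<noteq> 0"
      by (simp add: X_supp_def)
    then have "(\<Sum>x\<in>{x \<in> ?S. ?g x = (a, j, b)}. ?F x) \<noteq> 0"
      unfolding terms .
    then obtain y where "y \<in> {x \<in> ?S. ?g x = (a, j, b)}"
      by (rule sum.not_neutral_contains_not_neutral)
    then show "x \<in> ?g ` ?S" unfolding abj by (intro image_eqI [of _ _ y]) simp_all
  qed
  have fin: "finite (?g ` ?S)" by (intro finite_imageI finite_step_index)
  show ?fin by (rule finite_subset [OF sub fin])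
  have "X_op \<alpha> (- int k) ?v = (\<Sum>y\<in>?g ` ?S. \<Sum>x\<in>{x \<in> ?S. ?g x = y}. ?F x)"
    unfolding X_op_eq_sum [OF fin sub]
  proof (rule sum.cong [OF refl])
    fix y :: "nat \<times> int \<times> nat"
    obtain a j b where y: "y = (a, j, b)" by (cases y) auto
    show "(case y of (a, j, b) \<Rightarrow> X_term \<alpha> (a, j, b) ?v when int a + j - int b = - (- int k)) =
        (\<Sum>x\<in>{x \<in> ?S. ?g x = y}. ?F x)"
      unfolding y prod.case by (rule terms)
  qed
  also have "\<dots> = (\<Sum>x\<in>?S. ?F x)"
    by (rule sum.group) (auto simp: finite_step_index)
  finally show ?eq .
qed

subsection \<open>Iteration\<close>

text \<open>Two consecutive weight equations differ by k - (2n + 2s + 1) \<alpha>, since (s + 1)(2n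
  + s + 1) - s (2n + s) = 2n + 2s + 1. This turns the absolute condition of
  \<open>index_seqs\<close> into the relative one of \<open>step_index\<close>.\<close>

lemma weight_step_iff:
  fixes n :: rat
  assumes "2 * n = of_int t"
    and "of_nat a = of_nat L - of_nat s * (2 * n + of_nat s) * of_nat \<alpha>"
  shows "of_nat b = of_nat (L + k) - of_nat (Suc s) * (2 * n + of_nat (Suc s)) * of_nat \<alpha> \<longleftrightarrow>
    int b = int a + int k - (t + 2 * int s + 1) * int \<alpha>"
proof -
  have "int b = int a + int k - (t + 2 * int s + 1) * int \<alpha> \<longleftrightarrow>
      (of_int (int b) :: rat) = of_int (int a + int k - (t + 2 * int s + 1) * int \<alpha>)"
    by (simp only: of_int_eq_iff)
  also have "of_int (int a + int k - (t + 2 * int s + 1) * int \<alpha>) =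
      (of_nat a + of_nat k - (2 * n + 2 * of_nat s + 1) * of_nat \<alpha> :: rat)"
    by (simp add: assms(1))
  also have "\<dots> = of_nat (L + k) - of_nat (Suc s) * (2 * n + of_nat (Suc s)) * of_nat \<alpha>"
    unfolding assms(2) by (simp add: algebra_simps)
  finally show ?thesis by simp
qed

section \<open>Extending index sequences by one step\<close>

lemma index_seqs_Nil: "index_seqs \<alpha> n [] = {((\<lambda>i\<in>{0}. {#}), (\<lambda>i. undefined))}"
  by (auto simp: index_seqs_def PiE_iff extensional_def fun_eq_iff)

text \<open>A condition at i involves only i and i - 1, and the first i parts of the two lists agree
  for \<open>i \<le> s\<close>, so only the conditions at \<open>Suc s\<close> are new. The label t
  + 2s belongs to the basis element reached after s steps.\<close>

lemma index_seqs_snoc: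
  fixes n :: rat
  assumes t: "2 * n = of_int t" and s: "s = length lam"
  shows "(\<mu>, \<nu>) \<in> index_seqs \<alpha> n (lam @ [k]) \<longleftrightarrow>
    \<mu> \<in> extensional {0..Suc s} \<and> \<nu> \<in> extensional {1..Suc s} \<and>
    (restrict \<mu> {0..s}, restrict \<nu> {1..s}) \<in> index_seqs \<alpha> n lam \<and>
    (\<mu> (Suc s), \<nu> (Suc s)) \<in> step_index \<alpha> (t + 2 * int s) k (\<mu> s)" (is "?L \<longleftrightarrow> ?R")
proof -
  let ?w = "\<lambda>lam i. of_nat (sum_mset (\<mu> i)) =
    of_nat (sum_list (take i lam)) - of_nat i * (2 * n + of_nat i) * (of_nat \<alpha> :: rat)"
  let ?C = "\<lambda>i. \<nu> i \<subseteq># \<mu> i \<and> \<mu> i - \<nu> i \<subseteq># \<mu> (i - 1)"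
  have 0: "{0..Suc s} = insert (Suc s) {0..s}" "{1..Suc s} = insert (Suc s) {1..s}" by auto
  have "?L \<longleftrightarrow> \<mu> \<in> extensional {0..Suc s} \<and> \<nu> \<in> extensional {1..Suc s} \<and>
      (\<forall>i\<in>{0..Suc s}. \<mu> i \<in> partitions) \<and> (\<forall>i\<in>{1..Suc s}. \<nu> i \<in> partitions) \<and> \<mu> 0 = {#} \<and>
      (\<forall>i\<in>{1..Suc s}. ?C i \<and> ?w (lam @ [k]) i)"
    by (auto simp: index_seqs_def PiE_iff s simp del: of_nat_sum_mset)
  also have "\<dots> \<longleftrightarrow> \<mu> \<in> extensional {0..Suc s} \<and> \<nu> \<in> extensional {1..Suc s} \<and>
      ((\<forall>i\<in>{0..s}. \<mu> i \<in> partitions) \<and> (\<forall>i\<in>{1..s}. \<nu> i \<in> partitions) \<and> \<mu> 0 = {#} \<and>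
      (\<forall>i\<in>{1..s}. ?C i \<and> ?w lam i)) \<and>
      (\<mu> (Suc s) \<in> partitions \<and> \<nu> (Suc s) \<in> partitions \<and> ?C (Suc s) \<and> ?w (lam @ [k]) (Suc s))"
    unfolding 0 by (auto simp: s simp del: of_nat_sum_mset)
  also have "((\<forall>i\<in>{0..s}. \<mu> i \<in> partitions) \<and> (\<forall>i\<in>{1..s}. \<nu> i \<in> partitions) \<and> \<mu> 0 = {#} \<and>
      (\<forall>i\<in>{1..s}. ?C i \<and> ?w lam i)) \<longleftrightarrow> (restrict \<mu> {0..s}, restrict \<nu> {1..s}) \<in> index_seqs \<alpha> n lam"
    by (auto simp: index_seqs_def s simp del: of_nat_sum_mset)
  also have "(\<mu> \<in> extensional {0..Suc s} \<and> \<nu> \<in> extensional {1..Suc s} \<and>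
      (restrict \<mu> {0..s}, restrict \<nu> {1..s}) \<in> index_seqs \<alpha> n lam \<and>
      (\<mu> (Suc s) \<in> partitions \<and> \<nu> (Suc s) \<in> partitions \<and> ?C (Suc s) \<and> ?w (lam @ [k]) (Suc s))) \<longleftrightarrow> ?R"
  proof (intro conj_cong refl)
    assume "(restrict \<mu> {0..s}, restrict \<nu> {1..s}) \<in> index_seqs \<alpha> n lam"
    then have "\<mu> 0 = {#}" and w: "\<forall>i\<in>{1..s}. ?w lam i"
      by (auto simp: index_seqs_def s simp del: of_nat_sum_mset)
    \<comment> \<open>For s = 0 the weight equation is not among the conditions; it then follows
      from \<open>\<mu> 0 = {#}\<close>.\<close>
    then have "?w lam s"
      using bspec [OF w, of s] by (cases "s = 0") auto
    then have "of_nat (sum_mset (\<mu> s)) =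
        of_nat (sum_list lam) - of_nat s * (2 * n + of_nat s) * (of_nat \<alpha> :: rat)"
      by (simp add: s del: of_nat_sum_mset)
    from weight_step_iff [OF t this, of "sum_mset (\<mu> (Suc s))" k]
    show "(\<mu> (Suc s) \<in> partitions \<and> \<nu> (Suc s) \<in> partitions \<and> ?C (Suc s) \<and> ?w (lam @ [k]) (Suc s)) \<longleftrightarrow>
        (\<mu> (Suc s), \<nu> (Suc s)) \<in> step_index \<alpha> (t + 2 * int s) k (\<mu> s)"
      by (auto simp: step_index_def s simp del: of_nat_sum_mset of_nat_Suc)
  qed
  finally show ?thesis .
qed

text \<open>Finiteness of the index set is part of the induction because \<open>X_op\<close> may be
  applied termwise only to a finite sum.\<close>

lemma fold_X_op:
  fixes n :: rat
  assumes "\<alpha> > 0" and t: "2 * n = of_int t"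
  shows "finite (index_seqs \<alpha> n lam) \<and>
    fold (\<lambda>k. X_op \<alpha> (- int k)) lam (Poly_Mapping.single t (nmono {#})) =
    (\<Sum>(\<mu>, \<nu>)\<in>index_seqs \<alpha> n lam.
       smul (\<Prod>i=1..length lam. step_coeff \<alpha> (\<mu> (i - 1)) (\<mu> i) (\<nu> i))
         (Poly_Mapping.single (t + 2 * int (length lam)) (nmono (\<mu> (length lam)))))"
proof (induction lam rule: rev_induct)
  case Nil
  then show ?case by (simp add: index_seqs_Nil)
next
  case (snoc k lam)
  define s where "s = length lam"
  let ?I = "index_seqs \<alpha> n lam" and ?J = "index_seqs \<alpha> n (lam @ [k])"
  let ?c = "\<lambda>s (\<mu>, \<nu>). \<Prod>i=1..s. step_coeff \<alpha> (\<mu> (i - 1)) (\<mu> i) (\<nu> i)"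
  let ?v = "\<lambda>s p. Poly_Mapping.single (t + 2 * int s) (nmono p)"
  let ?st = "\<lambda>x. step_index \<alpha> (t + 2 * int s) k (fst x s)"
  \<comment> \<open>The maps \<open>?ext\<close> and \<open>?res\<close> are mutually inverse
    between \<open>Sigma ?I ?st\<close> and \<open>?J\<close>; extensionality fixes the values
    outside the index ranges, so that restricting undoes the update.\<close>
  let ?ext = "\<lambda>((\<mu>, \<nu>), (p, r)). (\<mu>(Suc s := p), \<nu>(Suc s := r))"
  let ?res = "\<lambda>(\<mu>, \<nu>). ((restrict \<mu> {0..s}, restrict \<nu> {1..s}), (\<mu> (Suc s), \<nu> (Suc s)))"
  note mem = index_seqs_snoc [OF t s_def]
  have I: "\<mu> \<in> extensional {0..s}" "\<nu> \<in> extensional {1..s}" "\<mu> s \<in> partitions" if "(\<mu>, \<nu>) \<in> ?I" for \<mu> \<nu>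
    using that by (auto simp: index_seqs_def s_def PiE_iff)
  have ext_res: "?ext (?res y) = y" and res: "?res y \<in> Sigma ?I ?st" if "y \<in> ?J" for y
  proof -
    obtain \<mu> \<nu> where y: "y = (\<mu>, \<nu>)" by (cases y)
    with that have "\<mu> \<in> extensional {0..Suc s}" "\<nu> \<in> extensional {1..Suc s}"
      by (simp_all add: mem)
    then have "(restrict \<mu> {0..s})(Suc s := \<mu> (Suc s)) = \<mu>" "(restrict \<nu> {1..s})(Suc s := \<nu> (Suc s)) = \<nu>"
      by (auto simp: fun_eq_iff extensional_def)
    then show "?ext (?res y) = y" by (simp add: y)
    show "?res y \<in> Sigma ?I ?st" using that by (simp add: y mem)
  qed
  have res_ext: "?res (?ext x) = x" and ext: "?ext x \<in> ?J" if x: "x \<in> Sigma ?I ?st" for x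
  proof -
    obtain \<mu> \<nu> p r where x: "x = ((\<mu>, \<nu>), (p, r))" "(\<mu>, \<nu>) \<in> ?I"
      "(p, r) \<in> step_index \<alpha> (t + 2 * int s) k (\<mu> s)"
      using x by (cases x) auto
    have "restrict (\<mu>(Suc s := p)) {0..s} = \<mu>" "restrict (\<nu>(Suc s := r)) {1..s} = \<nu>"
      using I [OF x(2)] by (auto simp: fun_eq_iff extensional_def)
    moreover have "\<mu>(Suc s := p) \<in> extensional {0..Suc s}" "\<nu>(Suc s := r) \<in> extensional {1..Suc s}"
      using I [OF x(2)] by (auto simp: extensional_def)
    ultimately show "?res (?ext x) = x" "?ext x \<in> ?J"
      using x by (simp_all add: mem)
  qed
  have finI: "finite ?I" using snoc by blast
  have "?J \<subseteq> ?ext ` Sigma ?I ?st"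
  proof
    fix y assume "y \<in> ?J"
    then show "y \<in> ?ext ` Sigma ?I ?st"
      by (intro image_eqI [of _ _ "?res y"] ext_res [symmetric] res)
  qed
  then have finJ: "finite ?J"
    by (rule finite_subset) (intro finite_imageI finite_SigmaI finI finite_step_index)
  have fold_lam: "fold (\<lambda>k. X_op \<alpha> (- int k)) lam (Poly_Mapping.single t (nmono {#})) =
      (\<Sum>x\<in>?I. smul (?c s x) (?v s (fst x s)))"
    using snoc by (simp add: case_prod_unfold s_def)
  have "fold (\<lambda>k. X_op \<alpha> (- int k)) (lam @ [k]) (Poly_Mapping.single t (nmono {#})) =
      X_op \<alpha> (- int k) (\<Sum>x\<in>?I. smul (?c s x) (?v s (fst x s)))"
    by (simp only: fold_append fold_simps comp_apply fold_lam)
  also have "\<dots> = (\<Sum>x\<in>?I. smul (?c s x) (X_op \<alpha> (- int k) (?v s (fst x s))))"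
    by (intro X_op_sum finI X_op_single_nmono \<open>\<alpha> > 0\<close>) (auto simp: I(3))
  also have "\<dots> = (\<Sum>x\<in>?I. \<Sum>(p, r)\<in>?st x.
      smul (?c s x * step_coeff \<alpha> (fst x s) p r) (?v (Suc s) p))"
  proof (intro sum.cong refl)
    fix x assume x: "x \<in> ?I"
    have p: "fst x s \<in> partitions" using x I(3) by (cases x) auto
    have "t + 2 * int s + 2 = t + 2 * int (Suc s)" by simp
    then show "smul (?c s x) (X_op \<alpha> (- int k) (?v s (fst x s))) =
      (\<Sum>(p, r)\<in>?st x. smul (?c s x * step_coeff \<alpha> (fst x s) p r) (?v (Suc s) p))"
      unfolding X_op_single_nmono(2) [OF \<open>\<alpha> > 0\<close> p] V.scale_sum_right
      by (simp only: case_prod_unfold V.scale_scale)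
  qed
  also have "\<dots> = (\<Sum>(x, (p, r))\<in>Sigma ?I ?st.
      smul (?c s x * step_coeff \<alpha> (fst x s) p r) (?v (Suc s) p))"
    by (subst sum.Sigma) (auto simp: finI finite_step_index case_prod_unfold)
  also have "\<dots> = (\<Sum>y\<in>?J. smul (?c (Suc s) y) (?v (Suc s) (fst y (Suc s))))"
  proof (rule sum.reindex_bij_witness [where i = ?res and j = ?ext])
    fix x assume x: "x \<in> Sigma ?I ?st"
    obtain \<mu> \<nu> p r where x': "x = ((\<mu>, \<nu>), (p, r))" by (metis prod.exhaust)
    \<comment> \<open>For \<open>i \<le> s\<close> both i and i - 1 differ from
      \<open>Suc s\<close>, so the update leaves these factors alone; the one new factor is split
      off at the upper end.\<close>
    have "(\<Prod>i=1..s. step_coeff \<alpha> ((\<mu>(Suc s := p)) (i - 1)) ((\<mu>(Suc s := p)) i) ((\<nu>(Suc s := r)) i)) =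
        (\<Prod>i=1..s. step_coeff \<alpha> (\<mu> (i - 1)) (\<mu> i) (\<nu> i))"
      by (intro prod.cong refl) auto
    then show "smul (?c (Suc s) (?ext x)) (?v (Suc s) (fst (?ext x) (Suc s))) =
        (case x of (x, (p, r)) \<Rightarrow> smul (?c s x * step_coeff \<alpha> (fst x s) p r) (?v (Suc s) p))"
      by (simp add: x' prod.nat_ivl_Suc')
  qed (use ext_res res ext res_ext in \<open>simp_all only:\<close>)
  finally show ?case
    using finJ by (simp add: case_prod_unfold s_def)
qed

theorem theorem3p2:
  fixes \<alpha> s :: nat and n :: rat and lam :: "nat list"
  assumes "\<alpha> > 0"
    and "s \<ge> 1"
    and "2 * n \<in> \<int>"
    and "length lam = s"
    and "sorted_wrt (\<ge>) lam"
  shows "fold (\<lambda>k. X_op \<alpha> (- int k)) lam (tensor 1 n) =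
    (\<Sum>(\<mu>, \<nu>) \<in> index_seqs \<alpha> n lam.
       smul (\<Prod>i=1..s. (- 2 * of_nat \<alpha>) ^ size (\<nu> i) / of_nat (zee (\<nu> i))
                * of_nat (mbinom (\<mu> (i - 1)) (\<mu> i - \<nu> i)))
         (tensor (smul0 (1 / (- 2) ^ size (\<mu> s)) (hmono (\<mu> s))) (n + of_nat s)))"
proof -
  from \<open>2 * n \<in> \<int>\<close> obtain t where t: "2 * n = of_int t" by (elim Ints_cases)
  \<comment> \<open>The floor in \<open>tensor\<close> loses nothing, since 2 (n + s) is an
    integer.\<close>
  have "2 * (n + of_nat s) = of_int (t + 2 * int s)" by (simp add: t)
  then have "\<lfloor>2 * (n + of_nat s)\<rfloor> = t + 2 * int s" by (simp only: floor_of_int)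
  then have tens: "tensor f (n + of_nat s) = Poly_Mapping.single (t + 2 * int s) f" for f
    by (simp only: tensor_def)
  have "tensor 1 n = Poly_Mapping.single t (nmono {#})"
    by (simp add: tensor_def t nmono_def)
  then show ?thesis
    using fold_X_op [OF \<open>\<alpha> > 0\<close> t, of lam]
    by (simp only: tens nmono_def step_coeff_def \<open>length lam = s\<close>)
qed

end
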